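(* Let $m\ge 2$ and $n\ge 1$. There is a bijection between the set of small $m$-Schröder paths from $(0,\dots,0)$ to $(n,\dots,n)$ and the set of all increasing tableaux of shape $m\times n$ (i.e. $\bigcup_{k\ge 0}\mathrm{Inc}_k(m\times n)$).
   Context: An increasing tableau of shape $m\times n$ (rectangle with $m$ rows and $n$ columns) is a filling of the boxes with positive integers such that rows and columns are strictly increasing and, if $M$ is the largest entry, every integer $1,\dots,M$ appears at least once; $\mathrm{Inc}_k(m\times n)$ is the set of those with largest entry $mn-k$. A large $m$-Schröder path is a lattice path in $\mathbb{R}^m$ from $(0,\dots,0)$ to $(n,\dots,n)$ whose steps are nonzero vectors $(\xi_1,\dots,\xi_m)$ with each $\xi_i\in\{0,1\}$, and which lies in the region $\{(x_1,\dots,x_m): 0\le x_m\le x_{m-1}\le\cdots\le x_1\}$. A small $m$-Schröder path is a large $m$-Schröder path such that whenever the path, after some number of steps, is at a point $(x_1,\dots,x_m)$ with $x_j=x_{j+1}$, the next step $(\xi_1,\dots,\xi_m)$ does not have $\xi_j=\xi_{j+1}=1$. *)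

theory Defs
  imports Complex_Main "HOL-Library.FuncSet"
begin

text \<open>
  Boxes are pairs (row, column), counted from 1; the filling is extensional (undefined outside
  the rectangle), so that distinct functions are distinct fillings.
\<close>

definition boxes :: "nat \<Rightarrow> nat \<Rightarrow> (nat \<times> nat) set" where
  "boxes m n = {1..m} \<times> {1..n}"

definition largest_entry :: "nat \<Rightarrow> nat \<Rightarrow> (nat \<times> nat \<Rightarrow> nat) \<Rightarrow> nat" where
  "largest_entry m n T = Max (T ` boxes m n)"

definition increasing_tableau :: "nat \<Rightarrow> nat \<Rightarrow> (nat \<times> nat \<Rightarrow> nat) \<Rightarrow> bool" where
  "increasing_tableau m n T \<longleftrightarrow>
     T \<in> boxes m n \<rightarrow>\<^sub>E {1..} \<and>
     (\<forall>i\<in>{1..m}. \<forall>j\<in>{1..n}. \<forall>j'\<in>{1..n}. j < j' \<longrightarrow> T (i, j) < T (i, j')) \<and>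
     (\<forall>i\<in>{1..m}. \<forall>i'\<in>{1..m}. \<forall>j\<in>{1..n}. i < i' \<longrightarrow> T (i, j) < T (i', j)) \<and>
     (\<forall>v\<in>{1..largest_entry m n T}. \<exists>b\<in>boxes m n. T b = v)"

text \<open>
  The largest entry is required to be \<open>m * n - k\<close>; this is written additively because
  subtraction on the naturals truncates.
\<close>

definition Inc :: "nat \<Rightarrow> nat \<Rightarrow> nat \<Rightarrow> (nat \<times> nat \<Rightarrow> nat) set" where
  "Inc k m n = {T. increasing_tableau m n T \<and> largest_entry m n T + k = m * n}"

lemma Union_Inc: "(\<Union>k. Inc k m n) = {T. increasing_tableau m n T}"
proof -
  have "\<exists>k. largest_entry m n T + k = m * n" if T: "increasing_tableau m n T" for T
  proof -
    have sub: "{1..largest_entry m n T} \<subseteq> T ` boxes m n"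
    proof
      fix v assume "v \<in> {1..largest_entry m n T}"
      then obtain b where "b \<in> boxes m n" "T b = v"
        using T[unfolded increasing_tableau_def] by metis
      then show "v \<in> T ` boxes m n" by (metis imageI)
    qed
    have fin: "finite (boxes m n)" by (simp add: boxes_def)
    have "card {1..largest_entry m n T} \<le> card (boxes m n)"
      by (rule surj_card_le[OF fin sub])
    then have "largest_entry m n T \<le> m * n" by (simp add: boxes_def)
    then show ?thesis by presburger
  qed
  then show ?thesis
    by (auto simp: Inc_def)
qed

text \<open>
  Vectors with \<open>m\<close> coordinates are functions on the index set \<open>{1..m}\<close>, extensional in the case of
  steps. A path starting at the origin is represented by its list of steps, and
  \<open>position ps t\<close> is the point reached after \<open>t\<close> steps. The region is convex, so
  it contains the whole path as soon as it contains these points.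
\<close>

definition schroeder_steps :: "nat \<Rightarrow> (nat \<Rightarrow> int) set" where
  "schroeder_steps m = {\<xi> \<in> {1..m} \<rightarrow>\<^sub>E {0, 1}. \<exists>i\<in>{1..m}. \<xi> i \<noteq> 0}"

definition position :: "(nat \<Rightarrow> int) list \<Rightarrow> nat \<Rightarrow> nat \<Rightarrow> int" where
  "position ps t i = (\<Sum>s<t. (ps ! s) i)"

definition in_region :: "nat \<Rightarrow> (nat \<Rightarrow> int) \<Rightarrow> bool" where
  "in_region m x \<longleftrightarrow> 0 \<le> x m \<and> (\<forall>j\<in>{1..<m}. x (j + 1) \<le> x j)"

definition large_schroeder_path :: "nat \<Rightarrow> nat \<Rightarrow> (nat \<Rightarrow> int) list \<Rightarrow> bool" where
  "large_schroeder_path m n ps \<longleftrightarrow>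
     set ps \<subseteq> schroeder_steps m \<and>
     (\<forall>i\<in>{1..m}. position ps (length ps) i = int n) \<and>
     (\<forall>t\<le>length ps. in_region m (position ps t))"

definition small_schroeder_path :: "nat \<Rightarrow> nat \<Rightarrow> (nat \<Rightarrow> int) list \<Rightarrow> bool" where
  "small_schroeder_path m n ps \<longleftrightarrow>
     large_schroeder_path m n ps \<and>
     (\<forall>t<length ps. \<forall>j\<in>{1..<m}. position ps t j = position ps t (j + 1) \<longrightarrow>
        \<not> ((ps ! t) j = 1 \<and> (ps ! t) (j + 1) = 1))"

end

theory Submission
  imports Defs
begin

text \<open>
  The \<open>t\<close>-th step of the path of a tableau increments the coordinates of the rows that contain
  the entry \<open>t\<close>. Path and tableau then determine each other through the Galois connection
  \<open>T (i, j) \<le> t \<longleftrightarrow> j \<le> position ps t i\<close>: the region condition says that columns increase weakly,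
  and the excluded steps are exactly those that would create equal vertical neighbours.
\<close>

definition tableau_path :: "nat \<Rightarrow> nat \<Rightarrow> (nat \<times> nat \<Rightarrow> nat) \<Rightarrow> (nat \<Rightarrow> int) list" where
  "tableau_path m n T =
     map (\<lambda>t. \<lambda>i\<in>{1..m}. if \<exists>j\<in>{1..n}. T (i, j) = Suc t then 1 else 0) [0..<largest_entry m n T]"

text \<open>The entry in box \<open>(i, j)\<close> is the time at which coordinate \<open>i\<close>
  first reaches height \<open>j\<close>. For a large path this time is at most
  \<open>length ps\<close>, where every coordinate equals \<open>n\<close>, so the unspecified
  values of \<open>ps ! s\<close> past the end of the list never influence it.\<close>

definition path_tableau :: "nat \<Rightarrow> nat \<Rightarrow> (nat \<Rightarrow> int) list \<Rightarrow> nat \<times> nat \<Rightarrow> nat" where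
  "path_tableau m n ps = (\<lambda>(i, j)\<in>boxes m n. LEAST t. int j \<le> position ps t i)"

lemma position_0 [simp]: "position ps 0 i = 0"
  by (simp add: position_def)

lemma position_Suc: "position ps (Suc t) i = position ps t i + (ps ! t) i"
  by (simp add: position_def)

section \<open>From tableaux to paths\<close>

lemma increasing_tableauD:
  assumes "increasing_tableau m n T"
  shows increasing_tableau_pos: "\<lbrakk>i \<in> {1..m}; j \<in> {1..n}\<rbrakk> \<Longrightarrow> 1 \<le> T (i, j)"
    and increasing_tableau_row: "\<lbrakk>i \<in> {1..m}; j \<in> {1..n}; j' \<in> {1..n}; j < j'\<rbrakk> \<Longrightarrow> T (i, j) < T (i, j')"
    and increasing_tableau_col: "\<lbrakk>i \<in> {1..m}; i' \<in> {1..m}; j \<in> {1..n}; i < i'\<rbrakk> \<Longrightarrow> T (i, j) < T (i', j)"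
    and increasing_tableau_surj: "v \<in> {1..largest_entry m n T} \<Longrightarrow> \<exists>i\<in>{1..m}. \<exists>j\<in>{1..n}. T (i, j) = v"
    and increasing_tableau_ext: "T \<in> extensional (boxes m n)"
proof -
  note * = assms[unfolded increasing_tableau_def]
  show "1 \<le> T (i, j)" if "i \<in> {1..m}" "j \<in> {1..n}"
  proof -
    have "(i, j) \<in> boxes m n" using that by (simp add: boxes_def)
    then have "T (i, j) \<in> {1..}" using PiE_mem[OF conjunct1[OF *]] by blast
    then show ?thesis by simp
  qed
  show "T (i, j) < T (i, j')" if "i \<in> {1..m}" "j \<in> {1..n}" "j' \<in> {1..n}" "j < j'"
    using * that by blast
  show "T (i, j) < T (i', j)" if "i \<in> {1..m}" "i' \<in> {1..m}" "j \<in> {1..n}" "i < i'"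
    using * that by blast
  show "\<exists>i\<in>{1..m}. \<exists>j\<in>{1..n}. T (i, j) = v" if "v \<in> {1..largest_entry m n T}"
  proof -
    obtain b where "b \<in> boxes m n" "T b = v" using * \<open>v \<in> _\<close> by blast
    then show ?thesis unfolding boxes_def by (metis mem_Sigma_iff surj_pair)
  qed
  show "T \<in> extensional (boxes m n)"
    using * by (simp add: PiE_def)
qed

lemma entry_le_largest_entry:
  assumes "i \<in> {1..m}" "j \<in> {1..n}"
  shows "T (i, j) \<le> largest_entry m n T"
  unfolding largest_entry_def using assms by (intro Max_ge) (auto simp: boxes_def)

lemma length_tableau_path [simp]: "length (tableau_path m n T) = largest_entry m n T"
  by (simp add: tableau_path_def)

lemma nth_tableau_path:
  assumes "t < largest_entry m n T" "i \<in> {1..m}"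
  shows "(tableau_path m n T ! t) i = (if \<exists>j\<in>{1..n}. T (i, j) = Suc t then 1 else 0)"
  using assms by (simp add: tableau_path_def)

text \<open>Step \<open>t\<close>, counted from 0, records the entry \<open>Suc t\<close>, so after
  \<open>t\<close> steps exactly the entries up to \<open>t\<close> have been processed. Rows
  increase strictly, so each value adds at most one column to the count.\<close>

lemma position_tableau_path:
  assumes T: "increasing_tableau m n T" and i: "i \<in> {1..m}" and "t \<le> largest_entry m n T"
  shows "position (tableau_path m n T) t i = int (card {j\<in>{1..n}. T (i, j) \<le> t})"
  using assms(3)
proof (induction t)
  case 0
  have "{j\<in>{1..n}. T (i, j) \<le> 0} = {}"
    using increasing_tableau_pos[OF T i] by fastforce
  then show ?case by simp
next
  case (Suc t)
  have IH: "position (tableau_path m n T) t i = int (card {j\<in>{1..n}. T (i, j) \<le> t})"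
    using Suc by simp
  have step: "(tableau_path m n T ! t) i = (if \<exists>j\<in>{1..n}. T (i, j) = Suc t then 1 else 0)"
    using Suc.prems i by (intro nth_tableau_path) auto
  show ?case
  proof (cases "\<exists>j\<in>{1..n}. T (i, j) = Suc t")
    case True
    then obtain j where j: "j \<in> {1..n}" "T (i, j) = Suc t" by blast
    have uniq: "j' = j" if "j' \<in> {1..n}" "T (i, j') = Suc t" for j'
      using increasing_tableau_row[OF T i, of j j'] increasing_tableau_row[OF T i, of j' j] j that
      by (metis less_irrefl linorder_neqE_nat)
    have "{j\<in>{1..n}. T (i, j) \<le> Suc t} = insert j {j\<in>{1..n}. T (i, j) \<le> t}"
    proof (intro subset_antisym subsetI)
      fix k assume "k \<in> {j\<in>{1..n}. T (i, j) \<le> Suc t}"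
      then show "k \<in> insert j {j\<in>{1..n}. T (i, j) \<le> t}"
        using uniq[of k] by (cases "T (i, k) = Suc t") auto
    qed (use j in auto)
    then show ?thesis using j True IH step by (simp add: position_Suc)
  next
    case False
    then have "{j\<in>{1..n}. T (i, j) \<le> Suc t} = {j\<in>{1..n}. T (i, j) \<le> t}"
      by (auto simp: le_Suc_eq)
    then show ?thesis using False IH step by (simp add: position_Suc)
  qed
qed

text \<open>The columns counted by the position form an initial segment of the row, because the row
  increases. Its size is therefore at least \<open>j\<close> exactly when it contains
  \<open>j\<close>.\<close>

lemma le_position_tableau_path_iff:
  assumes T: "increasing_tableau m n T" and i: "i \<in> {1..m}" and t: "t \<le> largest_entry m n T"
    and j: "j \<in> {1..n}"
  shows "int j \<le> position (tableau_path m n T) t i \<longleftrightarrow> T (i, j) \<le> t"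
proof
  assume "T (i, j) \<le> t"
  have "T (i, k) \<le> t" if "k \<in> {1..j}" for k
    using increasing_tableau_row[OF T i _ j, of k] that j \<open>T (i, j) \<le> t\<close>
    by (cases "k = j") auto
  then have "{1..j} \<subseteq> {j\<in>{1..n}. T (i, j) \<le> t}" using j by auto
  from card_mono[OF _ this] show "int j \<le> position (tableau_path m n T) t i"
    by (simp add: position_tableau_path[OF T i t])
next
  assume le: "int j \<le> position (tableau_path m n T) t i"
  show "T (i, j) \<le> t"
  proof (rule ccontr)
    assume "\<not> T (i, j) \<le> t"
    \<comment> \<open>Every counted column lies strictly left of \<open>j\<close>, which leaves at
      most \<open>j - 1\<close> of them.\<close>
    have "k < j" if "k \<in> {1..n}" "T (i, k) \<le> t" for k
    proof (rule ccontr)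
      assume "\<not> k < j"
      then have "T (i, j) \<le> T (i, k)"
        using increasing_tableau_row[OF T i j that(1)] by (cases "k = j") auto
      then show False using that(2) \<open>\<not> T (i, j) \<le> t\<close> by simp
    qed
    then have "{j\<in>{1..n}. T (i, j) \<le> t} \<subseteq> {1..<j}" by auto
    from card_mono[OF _ this] have "card {j\<in>{1..n}. T (i, j) \<le> t} < j"
      using j by (simp add: less_eq_Suc_le) linarith
    then show False
      using le by (simp add: position_tableau_path[OF T i t])
  qed
qed

lemma small_schroeder_path_tableau_path:
  assumes T: "increasing_tableau m n T" and m: "m \<ge> 1"
  shows "small_schroeder_path m n (tableau_path m n T)"
proof -
  let ?ps = "tableau_path m n T"
  have "?ps ! t \<in> schroeder_steps m" if t: "t < largest_entry m n T" for t
  proof -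
    \<comment> \<open>That no value is skipped by the tableau is what makes each step a nonzero
      vector.\<close>
    obtain i j where ij: "i \<in> {1..m}" "j \<in> {1..n}" "T (i, j) = Suc t"
      using increasing_tableau_surj[OF T, of "Suc t"] t by force
    then have "(?ps ! t) i \<noteq> 0" using nth_tableau_path[OF t ij(1)] by auto
    moreover have "?ps ! t \<in> {1..m} \<rightarrow>\<^sub>E {0, 1}"
      using t by (auto simp: tableau_path_def)
    ultimately show ?thesis using ij(1) by (auto simp: schroeder_steps_def)
  qed
  then have steps: "set ?ps \<subseteq> schroeder_steps m"
    by (auto simp: in_set_conv_nth)
  have final: "position ?ps (length ?ps) i = int n" if i: "i \<in> {1..m}" for i
  proof -
    have "{j\<in>{1..n}. T (i, j) \<le> largest_entry m n T} = {1..n}"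
      using entry_le_largest_entry[OF i] by auto
    then show ?thesis using position_tableau_path[OF T i order_refl] by simp
  qed
  have region: "in_region m (position ?ps t)" if t: "t \<le> length ?ps" for t
    unfolding in_region_def
  proof (intro conjI ballI)
    show "0 \<le> position ?ps t m" using position_tableau_path[OF T _, of m t] t m by simp
    fix i assume i: "i \<in> {1..<m}"
    then have i': "i \<in> {1..m}" "i + 1 \<in> {1..m}" by auto
    \<comment> \<open>An entry of row \<open>i + 1\<close> that is at most \<open>t\<close> has a
      smaller entry directly above it.\<close>
    have "{j\<in>{1..n}. T (i + 1, j) \<le> t} \<subseteq> {j\<in>{1..n}. T (i, j) \<le> t}"
      using increasing_tableau_col[OF T i'] by force
    from card_mono[OF _ this] show "position ?ps t (i + 1) \<le> position ?ps t i"
      using position_tableau_path[OF T i'(1)] position_tableau_path[OF T i'(2)] t by simp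
  qed
  have small: "\<not> ((?ps ! t) i = 1 \<and> (?ps ! t) (i + 1) = 1)"
    if t: "t < length ?ps" and i: "i \<in> {1..<m}"
      and eq: "position ?ps t i = position ?ps t (i + 1)" for t i
  proof
    assume both: "(?ps ! t) i = 1 \<and> (?ps ! t) (i + 1) = 1"
    have i': "i \<in> {1..m}" "i + 1 \<in> {1..m}" using i by auto
    have t': "t < largest_entry m n T" "t \<le> largest_entry m n T"
      "Suc t \<le> largest_entry m n T" using t by auto
    obtain j j' where j: "j \<in> {1..n}" "T (i, j) = Suc t"
      and j': "j' \<in> {1..n}" "T (i + 1, j') = Suc t"
      using both nth_tableau_path[OF t'(1)] i' by (metis zero_neq_one)
    \<comment> \<open>Height \<open>j\<close> is not reached at time \<open>t\<close> but is reached
      one unit step later, which fixes the column. Equal heights then put two equal entries into one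
      column.\<close>
    have "int j = position ?ps t i + 1" "int j' = position ?ps t (i + 1) + 1"
      using le_position_tableau_path_iff[OF T i'(1) t'(2) j(1)]
        le_position_tableau_path_iff[OF T i'(1) t'(3) j(1)]
        le_position_tableau_path_iff[OF T i'(2) t'(2) j'(1)]
        le_position_tableau_path_iff[OF T i'(2) t'(3) j'(1)] both j j'
      by (auto simp: position_Suc)
    then have "j = j'" using eq by simp
    then show False using increasing_tableau_col[OF T i' j(1)] j j' by simp
  qed
  show ?thesis
    unfolding small_schroeder_path_def large_schroeder_path_def
    using steps final region small by blast
qed

section \<open>From paths to tableaux\<close>

lemma step_cases:
  assumes "set ps \<subseteq> schroeder_steps m" "t < length ps" "i \<in> {1..m}"
  shows "(ps ! t) i = 0 \<or> (ps ! t) i = 1"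
proof -
  have "ps ! t \<in> {1..m} \<rightarrow>\<^sub>E {0, 1}"
    using assms(1) nth_mem[OF assms(2)] by (auto simp: schroeder_steps_def)
  from PiE_mem[OF this assms(3)] show ?thesis by auto
qed

lemma position_mono:
  assumes ps: "set ps \<subseteq> schroeder_steps m" and i: "i \<in> {1..m}" and "s \<le> t" "t \<le> length ps"
  shows "position ps s i \<le> position ps t i"
  using assms(3,4)
proof (induction t rule: dec_induct)
  case (step t)
  then show ?case using step_cases[OF ps _ i, of t] by (auto simp: position_Suc)
qed simp

text \<open>The same Galois connection, now for an arbitrary large path: steps are nonnegative, so a
  height once reached stays reached. Monotonicity is available only within the list, hence the bound
  on \<open>t\<close>.\<close>

lemma path_tableau_le_iff:
  assumes ps: "large_schroeder_path m n ps" and i: "i \<in> {1..m}" and j: "j \<in> {1..n}"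
    and t: "t \<le> length ps"
  shows "path_tableau m n ps (i, j) \<le> t \<longleftrightarrow> int j \<le> position ps t i"
proof -
  have T: "path_tableau m n ps (i, j) = (LEAST t. int j \<le> position ps t i)"
    using i j by (simp add: path_tableau_def boxes_def)
  have "int j \<le> position ps (length ps) i"
    using ps i j by (simp add: large_schroeder_path_def)
  then have "int j \<le> position ps (path_tableau m n ps (i, j)) i"
    unfolding T by (rule LeastI)
  moreover have "set ps \<subseteq> schroeder_steps m"
    using ps by (simp add: large_schroeder_path_def)
  ultimately show ?thesis
    using position_mono[OF _ i _ t] by (metis T Least_le order_trans)
qed

lemma path_tableau_bounds:
  assumes ps: "large_schroeder_path m n ps" and i: "i \<in> {1..m}" and j: "j \<in> {1..n}"
  shows "path_tableau m n ps (i, j) \<in> {1..length ps}"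
proof -
  have "path_tableau m n ps (i, j) \<le> length ps"
    using path_tableau_le_iff[OF ps i j order_refl] ps i j by (simp add: large_schroeder_path_def)
  moreover have "\<not> path_tableau m n ps (i, j) \<le> 0"
    using path_tableau_le_iff[OF ps i j, of 0] j by simp
  ultimately show ?thesis by simp
qed

text \<open>Obtained by comparing the Galois connection at times \<open>t\<close> and
  \<open>Suc t\<close>. A coordinate moves by at most 1, so height \<open>j\<close> is first reached
  from exactly \<open>j - 1\<close>.\<close>

lemma path_tableau_eq_Suc_iff:
  assumes ps: "large_schroeder_path m n ps" and i: "i \<in> {1..m}" and j: "j \<in> {1..n}"
    and t: "t < length ps"
  shows "path_tableau m n ps (i, j) = Suc t \<longleftrightarrow> (ps ! t) i = 1 \<and> int j = position ps t i + 1"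
proof -
  have step: "(ps ! t) i = 0 \<or> (ps ! t) i = 1"
    using ps step_cases[OF _ t i] unfolding large_schroeder_path_def by blast
  have "path_tableau m n ps (i, j) = Suc t \<longleftrightarrow>
      path_tableau m n ps (i, j) \<le> Suc t \<and> \<not> path_tableau m n ps (i, j) \<le> t" by auto
  also have "\<dots> \<longleftrightarrow> int j \<le> position ps (Suc t) i \<and> \<not> int j \<le> position ps t i"
    using path_tableau_le_iff[OF ps i j] t by simp
  also have "\<dots> \<longleftrightarrow> (ps ! t) i = 1 \<and> int j = position ps t i + 1"
    using step by (auto simp: position_Suc)
  finally show ?thesis .
qed

text \<open>This reads a step back off the tableau; it serves both to show that no value is skipped
  and to recover the path.\<close>

lemma ex_path_tableau_eq_Suc_iff:
  assumes ps: "large_schroeder_path m n ps" and i: "i \<in> {1..m}" and t: "t < length ps"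
  shows "(\<exists>j\<in>{1..n}. path_tableau m n ps (i, j) = Suc t) \<longleftrightarrow> (ps ! t) i = 1"
proof
  assume step: "(ps ! t) i = 1"
  have steps: "set ps \<subseteq> schroeder_steps m" and final: "position ps (length ps) i = int n"
    using ps i by (auto simp: large_schroeder_path_def)
  have "0 \<le> position ps t i" "position ps (Suc t) i \<le> int n"
    using position_mono[OF steps i, of 0 t] position_mono[OF steps i, of "Suc t" "length ps"]
      t final by auto
  \<comment> \<open>The column sought is the height just reached. It lies in range since the
    coordinate starts at 0 and climbs monotonically to \<open>n\<close>.\<close>
  then have "nat (position ps t i + 1) \<in> {1..n}" "int (nat (position ps t i + 1)) = position ps t i + 1"
    using step by (auto simp: position_Suc)
  then show "\<exists>j\<in>{1..n}. path_tableau m n ps (i, j) = Suc t"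
    using path_tableau_eq_Suc_iff[OF ps i _ t] step by blast
qed (use path_tableau_eq_Suc_iff[OF ps i _ t] in blast)

lemma path_tableau_surj:
  assumes ps: "large_schroeder_path m n ps" and v: "v \<in> {1..length ps}"
  shows "\<exists>b\<in>boxes m n. path_tableau m n ps b = v"
proof -
  obtain t where t: "v = Suc t" "t < length ps" using v by (cases v) auto
  have steps: "set ps \<subseteq> schroeder_steps m" using ps by (simp add: large_schroeder_path_def)
  then have "ps ! t \<in> schroeder_steps m" using t(2) nth_mem by blast
  then obtain i where i: "i \<in> {1..m}" "(ps ! t) i \<noteq> 0"
    by (auto simp: schroeder_steps_def)
  then have "(ps ! t) i = 1" using step_cases[OF steps t(2) i(1)] by simp
  then obtain j where "j \<in> {1..n}" "path_tableau m n ps (i, j) = Suc t"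
    using ex_path_tableau_eq_Suc_iff[OF ps i(1) t(2)] by blast
  then show ?thesis using i(1) t(1) by (intro bexI[of _ "(i, j)"]) (auto simp: boxes_def)
qed

lemma largest_entry_path_tableau:
  assumes ps: "large_schroeder_path m n ps" and "m \<ge> 1" "n \<ge> 1"
  shows "largest_entry m n (path_tableau m n ps) = length ps"
proof -
  \<comment> \<open>The box \<open>(1, 1)\<close> exists, so the path has at least one step; only
    then is \<open>length ps\<close> a positive value that must occur as an entry.\<close>
  have "path_tableau m n ps (1, 1) \<in> {1..length ps}"
    using assms by (intro path_tableau_bounds) auto
  then have "length ps \<in> {1..length ps}" by simp
  from path_tableau_surj[OF ps this] obtain b
    where b: "b \<in> boxes m n" "path_tableau m n ps b = length ps" by blast
  show ?thesis
    unfolding largest_entry_def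
  proof (rule Max_eqI)
    show "length ps \<in> path_tableau m n ps ` boxes m n" using b by (metis imageI)
    show "v \<le> length ps" if "v \<in> path_tableau m n ps ` boxes m n" for v
      using path_tableau_bounds[OF ps] that by (fastforce simp: boxes_def)
  qed (simp add: boxes_def)
qed

text \<open>Just before coordinate \<open>i\<close> reaches \<open>j'\<close> it stands at
  \<open>j' - 1\<close>, so the smaller height \<open>j\<close> has been reached already.\<close>

lemma path_tableau_row:
  assumes ps: "large_schroeder_path m n ps" and i: "i \<in> {1..m}"
    and j: "j \<in> {1..n}" and j': "j' \<in> {1..n}" and less: "j < j'"
  shows "path_tableau m n ps (i, j) < path_tableau m n ps (i, j')"
proof -
  obtain t where t: "path_tableau m n ps (i, j') = Suc t" "t < length ps"
    using path_tableau_bounds[OF ps i j'] by (cases "path_tableau m n ps (i, j')") auto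
  then have "int j' = position ps t i + 1"
    using path_tableau_eq_Suc_iff[OF ps i j' t(2)] by simp
  then have "path_tableau m n ps (i, j) \<le> t"
    using path_tableau_le_iff[OF ps i j, of t] t less by simp
  then show ?thesis using t by simp
qed

text \<open>The region condition at the moment row \<open>Suc i\<close> reaches \<open>j\<close>
  gives the weak inequality. Equality would mean that both rows leave the common height
  \<open>j - 1\<close> in one step, which a small path forbids.\<close>

lemma path_tableau_col_Suc:
  assumes small: "small_schroeder_path m n ps" and i: "i \<in> {1..<m}" and j: "j \<in> {1..n}"
  shows "path_tableau m n ps (i, j) < path_tableau m n ps (Suc i, j)"
proof -
  have ps: "large_schroeder_path m n ps" using small by (simp add: small_schroeder_path_def)
  have i': "i \<in> {1..m}" "Suc i \<in> {1..m}" using i by auto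
  obtain t where t: "path_tableau m n ps (Suc i, j) = Suc t" "t < length ps"
    using path_tableau_bounds[OF ps i'(2) j] by (cases "path_tableau m n ps (Suc i, j)") auto
  have eq: "(ps ! t) (Suc i) = 1" "int j = position ps t (Suc i) + 1"
    using path_tableau_eq_Suc_iff[OF ps i'(2) j t(2)] t(1) by auto
  have "position ps (Suc t) (Suc i) \<le> position ps (Suc t) i"
    using ps i t(2) by (auto simp: large_schroeder_path_def in_region_def)
  then have "path_tableau m n ps (i, j) \<le> Suc t"
    using path_tableau_le_iff[OF ps i'(1) j, of "Suc t"] t(2) eq by (simp add: position_Suc)
  moreover have "path_tableau m n ps (i, j) \<noteq> Suc t"
  proof
    assume "path_tableau m n ps (i, j) = Suc t"
    then have "(ps ! t) i = 1" "int j = position ps t i + 1"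
      using path_tableau_eq_Suc_iff[OF ps i'(1) j t(2)] by auto
    then show False using small i t(2) eq by (auto simp: small_schroeder_path_def)
  qed
  ultimately show ?thesis using t by simp
qed

lemma path_tableau_col:
  assumes small: "small_schroeder_path m n ps" and i: "i \<in> {1..m}" and j: "j \<in> {1..n}"
    and "Suc i \<le> i'" "i' \<le> m"
  shows "path_tableau m n ps (i, j) < path_tableau m n ps (i', j)"
  using assms(4,5)
proof (induction i' rule: dec_induct)
  case base
  then show ?case using path_tableau_col_Suc[OF small _ j, of i] i by simp
next
  case (step k)
  then show ?case using path_tableau_col_Suc[OF small _ j, of k] i by fastforce
qed

lemma increasing_tableau_path_tableau:
  assumes small: "small_schroeder_path m n ps" and "m \<ge> 1" "n \<ge> 1"
  shows "increasing_tableau m n (path_tableau m n ps)"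
proof -
  have ps: "large_schroeder_path m n ps" using small by (simp add: small_schroeder_path_def)
  have "path_tableau m n ps \<in> boxes m n \<rightarrow>\<^sub>E {1..}"
  proof (rule PiE_I)
    fix b assume "b \<in> boxes m n"
    then show "path_tableau m n ps b \<in> {1..}"
      using path_tableau_bounds[OF ps] by (fastforce simp: boxes_def)
  qed (simp add: path_tableau_def)
  moreover have "\<forall>i\<in>{1..m}. \<forall>i'\<in>{1..m}. \<forall>j\<in>{1..n}. i < i' \<longrightarrow>
      path_tableau m n ps (i, j) < path_tableau m n ps (i', j)"
    using path_tableau_col[OF small] by auto
  ultimately show ?thesis
    unfolding increasing_tableau_def largest_entry_path_tableau[OF ps assms(2,3)]
    using path_tableau_row[OF ps] path_tableau_surj[OF ps] by blast
qed

section \<open>The bijection\<close>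

lemma path_tableau_tableau_path:
  assumes T: "increasing_tableau m n T"
  shows "path_tableau m n (tableau_path m n T) = T"
proof (rule extensionalityI)
  show "path_tableau m n (tableau_path m n T) \<in> extensional (boxes m n)"
    by (simp add: path_tableau_def)
  show "T \<in> extensional (boxes m n)" by (rule increasing_tableau_ext[OF T])
  fix b assume b: "b \<in> boxes m n"
  then obtain i j where ij: "b = (i, j)" "i \<in> {1..m}" "j \<in> {1..n}" by (auto simp: boxes_def)
  note iff = le_position_tableau_path_iff[OF T ij(2) _ ij(3)]
  have "(LEAST t. int j \<le> position (tableau_path m n T) t i) = T (i, j)"
  proof (rule Least_equality)
    show "int j \<le> position (tableau_path m n T) (T (i, j)) i"
      using iff entry_le_largest_entry[OF ij(2,3)] by blast
    \<comment> \<open>The Galois connection covers only times up to the largest entry; a later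
      \<open>t\<close> exceeds \<open>T (i, j)\<close> anyway.\<close>
    show "T (i, j) \<le> t" if "int j \<le> position (tableau_path m n T) t i" for t
      using iff that entry_le_largest_entry[OF ij(2,3), of T] by (metis linear order_trans)
  qed
  then show "path_tableau m n (tableau_path m n T) b = T b"
    using b ij(1) by (simp add: path_tableau_def)
qed

lemma tableau_path_path_tableau:
  assumes ps: "large_schroeder_path m n ps" and "m \<ge> 1" "n \<ge> 1"
  shows "tableau_path m n (path_tableau m n ps) = ps"
proof (rule nth_equalityI)
  show len: "length (tableau_path m n (path_tableau m n ps)) = length ps"
    using largest_entry_path_tableau[OF assms] by simp
  fix t assume "t < length (tableau_path m n (path_tableau m n ps))"
  then have t: "t < length ps" using len by simp
  have steps: "set ps \<subseteq> schroeder_steps m" using ps by (simp add: large_schroeder_path_def)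
  show "tableau_path m n (path_tableau m n ps) ! t = ps ! t"
  \<comment> \<open>Both steps are extensional on \<open>{1..m}\<close>, so agreement of their
    coordinates there makes them equal as functions.\<close>
  proof (rule extensionalityI)
    show "tableau_path m n (path_tableau m n ps) ! t \<in> extensional {1..m}"
      using t len by (simp add: tableau_path_def)
    show "ps ! t \<in> extensional {1..m}"
      using steps nth_mem[OF t] by (auto simp: schroeder_steps_def PiE_def)
    fix i assume i: "i \<in> {1..m}"
    show "(tableau_path m n (path_tableau m n ps) ! t) i = (ps ! t) i"
      using nth_tableau_path[of t m n "path_tableau m n ps" i] t len i
        ex_path_tableau_eq_Suc_iff[OF ps i t] step_cases[OF steps t i] by auto
  qed
qed

theorem theorem2p9:
  fixes m n :: nat
  assumes "m \<ge> 2" and "n \<ge> 1"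
  shows "\<exists>f. bij_betw f {ps. small_schroeder_path m n ps} (\<Union>k. Inc k m n)"
proof -
  have m: "m \<ge> 1" using assms by simp
  have "bij_betw (path_tableau m n) {ps. small_schroeder_path m n ps} {T. increasing_tableau m n T}"
    using small_schroeder_path_tableau_path[OF _ m] increasing_tableau_path_tableau[OF _ m assms(2)]
      path_tableau_tableau_path tableau_path_path_tableau[OF _ m assms(2)]
    by (intro bij_betw_byWitness[where f' = "tableau_path m n"])
      (auto simp: small_schroeder_path_def)
  \<comment> \<open>Collecting all \<open>k\<close> loses no tableau: the largest entry is at most
    the number \<open>m * n\<close> of boxes.\<close>
  then show ?thesis unfolding Union_Inc by blast
qed

end
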